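(* Let $n$ be a positive integer and let $A_n$ be the alternating group on $\{1,2,\dots,n\}$. Then every nontrivial proper subgroup $H$ of $A_n$ is an FF-subgroup of $A_n$.
   Context: For a proper subgroup $H$ of a finite group $G$, let $\Delta_H(G)$ (the maximal cover of $H$ in $G$) denote the union, as a subset of $G$, of all maximal subgroups of $G$ containing $H$. The proper subgroup $H$ is called an FF-subgroup of $G$ if $\Delta_H(G)\neq G$. "Nontrivial" means different from the identity subgroup. *)

theory Defs
  imports "HOL-Algebra.Sym_Groups"
begin

definition proper_subgroup :: "'a set \<Rightarrow> ('a, 'b) monoid_scheme \<Rightarrow> bool" where
  "proper_subgroup H G \<longleftrightarrow> subgroup H G \<and> H \<noteq> carrier G"

definition maximal_subgroup :: "'a set \<Rightarrow> ('a, 'b) monoid_scheme \<Rightarrow> bool" where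
  "maximal_subgroup M G \<longleftrightarrow>
     proper_subgroup M G \<and> (\<forall>K. proper_subgroup K G \<and> M \<subseteq> K \<longrightarrow> K = M)"

definition maximal_cover :: "'a set \<Rightarrow> ('a, 'b) monoid_scheme \<Rightarrow> 'a set" where
  "maximal_cover H G = \<Union>{M. maximal_subgroup M G \<and> H \<subseteq> M}"

definition FF_subgroup :: "'a set \<Rightarrow> ('a, 'b) monoid_scheme \<Rightarrow> bool" where
  "FF_subgroup H G \<longleftrightarrow>
     group G \<and> finite (carrier G) \<and> proper_subgroup H G \<and> maximal_cover H G \<noteq> carrier G"

end

theory Submission
  imports Defs
begin

text \<open>
  If the maximal subgroups containing \<open>H\<close> covered \<open>A\<^sub>n\<close>, then, for a fixed nonidentity \<open>x \<in> H\<close>,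
  no element \<open>y\<close> could generate \<open>A\<^sub>n\<close> together with \<open>x\<close>: such a \<open>y\<close> lies in some maximal subgroup
  containing \<open>H\<close>, and hence \<open>x\<close>. So it suffices that every nonidentity \<open>x \<in> A\<^sub>n\<close> has a partner \<open>y\<close>
  with \<open>\<langle>x, y\<rangle> = A\<^sub>n\<close> (\<open>ex_generating_partner\<close>).

  The criterion for generation is elementary. In a subgroup \<open>K\<close> of \<open>A\<^sub>n\<close>, call two points linked if
  they are equal or some 3-cycle of \<open>K\<close> moves one to the other. Conjugating 3-cycles by one another
  shows that this is an equivalence relation and that any three points of one class form a 3-cycle
  in \<open>K\<close>; conjugating by arbitrary elements shows that \<open>K\<close> permutes the classes. Since 3-cycles
  generate \<open>A\<^sub>n\<close>, it is enough to see that all points are linked.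

  The partner is a product of a 3-cycle \<open>(a b c)\<close>, a long cycle \<open>M\<close> of length prime to 3, and at
  most a transposition \<open>D\<close>; the remaining points, at most two of them, are fixed. A power of \<open>y\<close> is
  then \<open>(a b c)\<close>, so that the class of \<open>a\<close> is a union of orbits of \<open>y\<close>, and these few orbits are laid
  out so that \<open>x\<close> joins them and no union of some, but not all, of them can be a class. Parity of
  \<open>y\<close> and the condition on \<open>|M|\<close> decide how many orbits there must be: two if \<open>n\<close> is even and prime to
  3, three if \<open>n\<close> is odd, and four if 6 divides \<open>n\<close>. An element \<open>x\<close> cannot join four orbits if it is
  a 3-cycle or a product of two transpositions. In these cases \<open>y\<close> is a cycle through all but one
  point, and the 3-cycle comes from \<open>x\<close> itself, or from a short word in \<open>x\<close> and \<open>y\<close>. On three points,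
  \<open>x\<close> alone generates.
\<close>

section \<open>Cycles\<close>

lemma cycle_of_list_funpow_length:
  assumes "distinct cs" and "length cs dvd k"
  shows "cycle_of_list cs ^^ k = id"
proof
  fix u
  show "(cycle_of_list cs ^^ k) u = id u"
  proof (cases "u \<in> set cs")
    case True
    then obtain i where i: "i < length cs" "u = cs ! i"
      by (metis in_set_conv_nth)
    have "(cycle_of_list cs ^^ k) (cs ! i) = map (cycle_of_list cs ^^ k) cs ! i"
      using i by simp
    also have "\<dots> = rotate k cs ! i"
      by (simp only: cyclic_rotation[OF assms(1)])
    also have "\<dots> = cs ! i"
      using i assms(2) by (simp add: rotate_id)
    finally show ?thesis
      using i by simp
  next
    case False
    have "(cycle_of_list cs ^^ k) u = u"
      by (induction k) (simp_all add: id_outside_supp[OF False])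
    then show ?thesis by simp
  qed
qed

lemma cycle_of_list_transitive:
  assumes "distinct cs" and "s \<in> set cs" and "t \<in> set cs"
  obtains k where "(cycle_of_list cs ^^ k) s = t"
proof -
  obtain i j where i: "i < length cs" "s = cs ! i" and j: "j < length cs" "t = cs ! j"
    using assms(2,3) by (metis in_set_conv_nth)
  define k where "k = j + (length cs - i)"
  have "(cycle_of_list cs ^^ k) (cs ! i) = map (cycle_of_list cs ^^ k) cs ! i"
    using i by simp
  also have "\<dots> = rotate k cs ! i"
    by (simp only: cyclic_rotation[OF assms(1)])
  also have "\<dots> = cs ! ((k + i) mod length cs)"
    using i by (simp add: nth_rotate)
  also have "(k + i) mod length cs = j"
    using i j by (simp add: k_def)
  finally show ?thesis
    using that i j by blast
qed

text \<open>Here \<open>y\<close> is only required to act on \<open>cs\<close> as the cycle does, so that the rule applies to products of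
  disjoint cycles.\<close>

lemma cycle_orbit_induct:
  assumes "distinct cs" and "\<And>u. u \<in> set cs \<Longrightarrow> y u = cycle_of_list cs u"
    and "\<And>u. u \<in> set cs \<Longrightarrow> P u \<Longrightarrow> P (y u)"
    and "s \<in> set cs" and "P s" and "t \<in> set cs"
  shows "P t"
proof -
  have "(cycle_of_list cs ^^ k) s \<in> set cs \<and> P ((cycle_of_list cs ^^ k) s)" for k
  proof (induction k)
    case (Suc k)
    then have "cycle_of_list cs ((cycle_of_list cs ^^ k) s) \<in> set cs"
      using permutes_in_image[OF cycle_permutes] by metis
    moreover have "P (cycle_of_list cs ((cycle_of_list cs ^^ k) s))"
      using Suc assms(2,3) by metis
    ultimately show ?case by simp
  qed (use assms in auto)
  then show ?thesis
    using cycle_of_list_transitive[OF assms(1,4,6)] by metis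
qed

lemma evenperm_cycle_of_list:
  "distinct cs \<Longrightarrow> evenperm (cycle_of_list cs) \<longleftrightarrow> even (length cs - 1)"
  using swapidseq_ext_imp_swapidseq[OF swapidseq_ext_of_cycles] evenperm_unique by blast

lemma cycle_in_alt_group:
  assumes "distinct cs" and "set cs \<subseteq> {1..n}" and "odd (length cs)"
  shows "cycle_of_list cs \<in> carrier (alt_group n)"
  using assms permutes_subset[OF cycle_permutes assms(2)]
  by (simp add: alt_group_carrier evenperm_cycle_of_list)

lemma conj_three_cycle:
  assumes "bij g" and "distinct [u, v, w]"
  shows "g \<circ> cycle_of_list [u, v, w] \<circ> inv' g = cycle_of_list [g u, g v, g w]"
  using conjugation_of_cycle[OF assms(2,1)] by simp

lemma three_cycle_rotate:
  "distinct [u, v, w] \<Longrightarrow> cycle_of_list [u, v, w] = cycle_of_list [v, w, u]"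
  by (rule ext) (auto simp: transpose_def)

lemma three_cycle_square:
  "distinct [u, v, w] \<Longrightarrow> cycle_of_list [u, v, w] \<circ> cycle_of_list [u, v, w] = cycle_of_list [w, v, u]"
  by (rule ext) (auto simp: transpose_def)

section \<open>Points linked by 3-cycles\<close>

locale alt_subgroup =
  fixes n :: nat and K :: "(nat \<Rightarrow> nat) set"
  assumes subgroup: "subgroup K (alt_group n)"
begin

lemma in_alt: "g \<in> K \<Longrightarrow> g \<in> carrier (alt_group n)"
  using subgroup subgroup.subset by blast

lemma permutes: "g \<in> K \<Longrightarrow> g permutes {1..n}"
  using in_alt by (simp add: alt_group_carrier)

lemma bij: "g \<in> K \<Longrightarrow> bij g"
  using permutes permutes_bij by blast

lemma comp_closed: "g \<in> K \<Longrightarrow> h \<in> K \<Longrightarrow> g \<circ> h \<in> K"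
  using subgroup.m_closed[OF subgroup] by (simp add: alt_group_mult)

lemma inv_closed: "g \<in> K \<Longrightarrow> inv' g \<in> K"
  using subgroup.m_inv_closed[OF subgroup, of g] alt_group_inv_equality[OF in_alt, of g] by simp

lemma funpow_closed: "g \<in> K \<Longrightarrow> g ^^ k \<in> K"
proof (induction k)
  case 0
  then show ?case
    using subgroup.one_closed[OF subgroup] by (simp add: alt_group_one id_def)
next
  case (Suc k)
  then show ?case using comp_closed unfolding funpow.simps(2) by blast
qed

definition three_cycle_in :: "nat \<Rightarrow> nat \<Rightarrow> nat \<Rightarrow> bool" where
  "three_cycle_in u v w \<longleftrightarrow> distinct [u, v, w] \<and> cycle_of_list [u, v, w] \<in> K"

definition linked :: "nat \<Rightarrow> nat \<Rightarrow> bool" where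
  "linked u v \<longleftrightarrow> u = v \<or> (\<exists>w. three_cycle_in u v w)"

definition link_class :: "nat \<Rightarrow> nat set" where
  "link_class u = {v. linked u v}"

lemma three_cycle_in_rotate: "three_cycle_in u v w \<Longrightarrow> three_cycle_in v w u"
  using three_cycle_rotate[of u v w] unfolding three_cycle_in_def by auto

lemma three_cycle_in_reverse: "three_cycle_in u v w \<Longrightarrow> three_cycle_in w v u"
  using comp_closed three_cycle_square[of u v w] unfolding three_cycle_in_def
  by (metis distinct_length_2_or_more distinct_singleton)

lemma three_cycle_in_image:
  assumes "g \<in> K" and "three_cycle_in u v w"
  shows "three_cycle_in (g u) (g v) (g w)"
proof -
  have d: "distinct [u, v, w]" and c: "cycle_of_list [u, v, w] \<in> K"
    using assms(2) unfolding three_cycle_in_def by auto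
  have "g \<circ> cycle_of_list [u, v, w] \<circ> inv' g \<in> K"
    using assms(1) c comp_closed inv_closed by blast
  then have "cycle_of_list [g u, g v, g w] \<in> K"
    using conj_three_cycle[OF bij[OF assms(1)] d] by simp
  moreover have "distinct [g u, g v, g w]"
    using d bij_is_inj[OF bij[OF assms(1)]] by (auto simp: inj_eq)
  ultimately show ?thesis
    unfolding three_cycle_in_def by blast
qed

lemma three_cycle_apply:
  assumes "three_cycle_in u v w"
  shows "cycle_of_list [u, v, w] u = v" "cycle_of_list [u, v, w] v = w"
    "cycle_of_list [u, v, w] w = u"
    "z \<notin> {u, v, w} \<Longrightarrow> cycle_of_list [u, v, w] z = z"
  using assms unfolding three_cycle_in_def by (auto simp: transpose_def)

text \<open>If the two 3-cycles share only \<open>v\<close>, then conjugating one by the other produces a 3-cycle that shares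
  two points with the first; conjugation among 3-cycles on the same four points then yields the
  desired one. Besides transitivity of linking, this shows that any three points of one class carry
  a 3-cycle of the group.\<close>

lemma three_cycle_in_chain:
  assumes uva: "three_cycle_in u v a" and vwb: "three_cycle_in v w b" and uw: "u \<noteq> w"
  shows "three_cycle_in u v w"
proof -
  have share: "three_cycle_in u v w" if uva: "three_cycle_in u v a" and vwa: "three_cycle_in v w a" for a
  proof -
    have "a \<notin> {u, v, w}" "u \<noteq> v" "v \<noteq> w"
      using uva vwa unfolding three_cycle_in_def by auto
    then have "cycle_of_list [v, w, a] u = u"
      using uw three_cycle_apply(4)[OF vwa, of u] by auto
    then have "three_cycle_in u w v"
      using three_cycle_in_image[of "cycle_of_list [v, w, a]", OF _ uva] vwa
        three_cycle_apply[OF vwa] unfolding three_cycle_in_def[of v w a] by simp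
    then show ?thesis
      using three_cycle_in_rotate three_cycle_in_reverse by blast
  qed
  have ne: "u \<noteq> v" "v \<noteq> w" "a \<noteq> u" "a \<noteq> v" "b \<noteq> v" "b \<noteq> w"
    using uva vwb unfolding three_cycle_in_def by auto
  consider "a = w" | "b = u" | "a = b" | "a \<noteq> w" "b \<noteq> u" "a \<noteq> b"
    by blast
  then show ?thesis
  proof cases
    case 1
    then show ?thesis using uva by simp
  next
    case 2
    then show ?thesis using vwb three_cycle_in_rotate by blast
  next
    case 3
    then show ?thesis using share uva vwb by blast
  next
    case 4
    \<comment> \<open>conjugating \<open>(u v a)\<close> by \<open>(v w b)\<close> replaces \<open>v\<close> by \<open>w\<close>\<close>
    have uwa: "three_cycle_in u w a"
      using three_cycle_in_image[of "cycle_of_list [v, w, b]", OF _ uva] vwb ne uw 4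
        three_cycle_apply[OF vwb] unfolding three_cycle_in_def[of v w b] by simp
    \<comment> \<open>conjugating \<open>(u v a)\<close> by \<open>(u w a)\<close> fixes \<open>v\<close> and gives \<open>(w v u)\<close>\<close>
    have "three_cycle_in w v u"
      using three_cycle_in_image[of "cycle_of_list [u, w, a]", OF _ uva] uwa ne uw 4
        three_cycle_apply[OF uwa] unfolding three_cycle_in_def[of u w a] by simp
    then show ?thesis
      using three_cycle_in_reverse by blast
  qed
qed

lemma linked_refl: "linked u u"
  unfolding linked_def by simp

lemma linked_sym: "linked u v \<Longrightarrow> linked v u"
  unfolding linked_def using three_cycle_in_rotate three_cycle_in_reverse by blast

lemma linked_trans: "linked u v \<Longrightarrow> linked v w \<Longrightarrow> linked u w"
  unfolding linked_def using three_cycle_in_chain three_cycle_in_rotate three_cycle_in_reverse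
  by metis

lemma linked_image: "g \<in> K \<Longrightarrow> linked u v \<Longrightarrow> linked (g u) (g v)"
  unfolding linked_def using three_cycle_in_image by blast

lemma linked_image_iff:
  assumes "g \<in> K"
  shows "linked (g u) (g v) \<longleftrightarrow> linked u v"
  using linked_image[OF assms] linked_image[OF inv_closed[OF assms], of "g u" "g v"]
    bij_is_inj[OF bij[OF assms]] by (auto simp: inv_f_f)

lemma linkedI_three_cycle:
  assumes "cycle_of_list [a, b, c] \<in> K" and "distinct [a, b, c]"
  shows "{a, b, c} \<subseteq> link_class a"
proof -
  have "three_cycle_in a b c" "three_cycle_in a c b"
    using assms three_cycle_in_rotate three_cycle_in_reverse unfolding three_cycle_in_def by blast+
  then show ?thesis
    unfolding link_class_def linked_def by blast
qed

lemma link_class_self: "u \<in> link_class u"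
  unfolding link_class_def using linked_refl by simp

lemma link_class_eq: "v \<in> link_class u \<Longrightarrow> link_class v = link_class u"
  unfolding link_class_def using linked_sym linked_trans by blast

lemma link_class_subset: "u \<in> {1..n} \<Longrightarrow> link_class u \<subseteq> {1..n}"
proof
  fix v
  assume u: "u \<in> {1..n}" and "v \<in> link_class u"
  then consider "v = u" | w where "three_cycle_in u v w"
    unfolding link_class_def linked_def by blast
  then show "v \<in> {1..n}"
  proof cases
    case 2
    then have "cycle_of_list [u, v, w] permutes {1..n}"
      using permutes unfolding three_cycle_in_def by blast
    then show ?thesis
      using u three_cycle_apply(1)[OF 2] permutes_in_image by metis
  qed (use u in simp)
qed

lemma link_class_image: "g \<in> K \<Longrightarrow> g ` link_class u = link_class (g u)"
proof
  assume g: "g \<in> K"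
  show "g ` link_class u \<subseteq> link_class (g u)"
    unfolding link_class_def using linked_image[OF g] by blast
  show "link_class (g u) \<subseteq> g ` link_class u"
  proof
    fix v
    assume "v \<in> link_class (g u)"
    moreover obtain v' where "v = g v'"
      using bij_is_surj[OF bij[OF g]] by blast
    ultimately show "v \<in> g ` link_class u"
      unfolding link_class_def using linked_image_iff[OF g] by blast
  qed
qed

lemma card_link_class_image: "g \<in> K \<Longrightarrow> card (link_class (g u)) = card (link_class u)"
  using link_class_image[of g u] card_image[of g "link_class u"] bij_is_inj[OF bij, of g]
  by (metis inj_on_subset subset_UNIV)

text \<open>The classes are blocks: an element that sends one point of a class into the class preserves it.\<close>

lemma link_class_stable:
  assumes "g \<in> K" and "u \<in> link_class a" and "g u \<in> link_class a" and "v \<in> link_class a"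
  shows "g v \<in> link_class a"
  using link_class_image[OF assms(1), of u] link_class_eq assms(2-4) by blast

lemma link_class_absorbs_cycle:
  assumes "y \<in> K" and "distinct M" and "\<And>u. u \<in> set M \<Longrightarrow> y u = cycle_of_list M u"
    and "u \<in> link_class a" and "y u \<in> link_class a"
    and "s \<in> set M" and "s \<in> link_class a"
  shows "set M \<subseteq> link_class a"
  using cycle_orbit_induct[of M y "\<lambda>u. u \<in> link_class a" s] link_class_stable[OF assms(1,4,5)] assms
  by blast

text \<open>If 3 does not divide \<open>n\<close>, this rules out that all classes have just the three points of a 3-cycle.\<close>

lemma card_link_class_dvd:
  assumes "\<And>u. u \<in> {1..n} \<Longrightarrow> card (link_class u) = k"
  shows "k dvd n"
proof -
  let ?C = "link_class ` {1..n}"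
  have U: "\<Union>?C = {1..n}"
    using link_class_subset link_class_self by blast
  have "k dvd card (\<Union>?C)"
  proof (rule dvd_partition)
    show "\<forall>c\<in>?C. k dvd card c"
      using assms by simp
    show "\<forall>c1\<in>?C. \<forall>c2\<in>?C. c1 \<noteq> c2 \<longrightarrow> c1 \<inter> c2 = {}"
      using link_class_eq by blast
  qed (use U in simp)
  then show ?thesis
    using U by simp
qed

lemma eq_alt_group_if_linked:
  assumes "{1..n} \<subseteq> link_class a"
  shows "K = carrier (alt_group n)"
proof
  show "K \<subseteq> carrier (alt_group n)"
    using in_alt by blast
  have all: "linked u v" if "u \<in> {1..n}" "v \<in> {1..n}" for u v
    using assms that linked_sym linked_trans unfolding link_class_def by blast
  have "three_cycles n \<subseteq> K"
  proof
    fix p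
    assume "p \<in> three_cycles n"
    then obtain cs where cs: "p = cycle_of_list cs" "cycle cs" "length cs = 3" "set cs \<subseteq> {1..n}"
      by auto
    obtain u v w where uvw: "cs = [u, v, w]"
      using stupid_lemma[OF cs(3)] by blast
    then have "linked u v" "linked v w" "u \<noteq> v" "v \<noteq> w" "u \<noteq> w"
      using all cs by auto
    then obtain a b where "three_cycle_in u v a" "three_cycle_in v w b"
      unfolding linked_def by blast
    then have "three_cycle_in u v w"
      using three_cycle_in_chain \<open>u \<noteq> w\<close> by blast
    then show "p \<in> K"
      unfolding three_cycle_in_def using cs uvw by simp
  qed
  then show "carrier (alt_group n) \<subseteq> K"
    using group.generate_subgroup_incl[OF alt_group_is_group _ subgroup]
    unfolding alt_group_carrier_as_three_cycles by blast
qed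

end

text \<open>Generation is expressed through the subgroups that contain both elements, because the covering
  argument produces such a subgroup.\<close>

definition generates_with :: "nat \<Rightarrow> (nat \<Rightarrow> nat) \<Rightarrow> (nat \<Rightarrow> nat) \<Rightarrow> bool" where
  "generates_with n x y \<longleftrightarrow> y \<in> carrier (alt_group n) \<and>
     (\<forall>K. subgroup K (alt_group n) \<and> x \<in> K \<and> y \<in> K \<longrightarrow> K = carrier (alt_group n))"

lemma generates_withI:
  assumes "y \<in> carrier (alt_group n)"
    and "\<And>K. alt_subgroup n K \<Longrightarrow> x \<in> K \<Longrightarrow> y \<in> K \<Longrightarrow> \<exists>a. {1..n} \<subseteq> alt_subgroup.link_class K a"
  shows "generates_with n x y"
  unfolding generates_with_def
  using assms alt_subgroup.eq_alt_group_if_linked alt_subgroup.intro by metis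

section \<open>Partners with a 3-cycle as a power\<close>

text \<open>Raising \<open>y\<close> to a multiple of \<open>length M\<close> kills both \<open>M\<close> and \<open>D\<close> but, as this length is prime to 3, need
  not kill the 3-cycle. The list \<open>D\<close> is there to correct the parity of \<open>y\<close>; since
  subtraction is truncated, an empty \<open>D\<close> counts as even.\<close>

locale three_cycle_partner =
  fixes n :: nat and a b c :: nat and M D :: "nat list" and y :: "nat \<Rightarrow> nat"
  assumes dist: "distinct ([a, b, c] @ M @ D)" and sub: "set ([a, b, c] @ M @ D) \<subseteq> {1..n}"
    and parity: "even ((length M - 1) + (length D - 1))"
    and ndvd: "\<not> 3 dvd length M" and dvd: "D = [] \<or> length D dvd length M"
    and y_def: "y = cycle_of_list [a, b, c] \<circ> (cycle_of_list M \<circ> cycle_of_list D)"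
begin

lemma y_simps: "y a = b" "y b = c" "y c = a" "u \<in> set M \<Longrightarrow> y u = cycle_of_list M u"
  "u \<in> set D \<Longrightarrow> y u = cycle_of_list D u" "u \<notin> set ([a, b, c] @ M @ D) \<Longrightarrow> y u = u"
proof -
  have [simp]: "cycle_of_list M v = v" if "v \<notin> set M" for v
    using that id_outside_supp by metis
  have [simp]: "cycle_of_list D v = v" if "v \<notin> set D" for v
    using that id_outside_supp by metis
  have [simp]: "cycle_of_list [a, b, c] v = v" if "v \<notin> {a, b, c}" for v
    using that id_outside_supp[of v "[a,b,c]"] by simp
  have M_closed [simp]: "cycle_of_list M v \<in> set M \<longleftrightarrow> v \<in> set M" for v
    using permutes_in_image[OF cycle_permutes] by metis
  have [simp]: "cycle_of_list D v \<in> set D \<longleftrightarrow> v \<in> set D" for v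
    using permutes_in_image[OF cycle_permutes] by metis
  have T: "cycle_of_list [a, b, c] a = b" "cycle_of_list [a, b, c] b = c" "cycle_of_list [a, b, c] c = a"
    using dist by (auto simp: transpose_def)
  have nT: "a \<notin> set M" "a \<notin> set D" "b \<notin> set M" "b \<notin> set D" "c \<notin> set M" "c \<notin> set D"
    using dist by auto
  have MD: "set M \<inter> set D = {}"
    using dist by auto
  show "y a = b" "y b = c" "y c = a"
    unfolding y_def using T nT by (simp_all del: cycle_of_list.simps)
  show "y u = cycle_of_list M u" if "u \<in> set M"
  proof -
    have "cycle_of_list M u \<notin> {a, b, c}" "u \<notin> set D"
      using that nT MD by (metis M_closed insertE singletonD, auto)
    then show ?thesis
      unfolding y_def by (simp del: cycle_of_list.simps)
  qed
  show "y u = cycle_of_list D u" if "u \<in> set D"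
  proof -
    have "cycle_of_list D u \<in> set D"
      using that by simp
    then have "cycle_of_list D u \<notin> {a, b, c}" "cycle_of_list D u \<notin> set M"
      using nT MD by auto
    then show ?thesis
      unfolding y_def by (simp del: cycle_of_list.simps)
  qed
  show "y u = u" if "u \<notin> set ([a, b, c] @ M @ D)"
    unfolding y_def using that by (simp del: cycle_of_list.simps)
qed

lemma y_in_alt: "y \<in> carrier (alt_group n)"
proof -
  have d: "distinct [a, b, c]" "distinct M" "distinct D"
    using dist by auto
  have p: "cycle_of_list cs permutes {1..n}" if "set cs \<subseteq> {1..n}" for cs
    using permutes_subset[OF cycle_permutes that] .
  have "y permutes {1..n}"
    unfolding y_def using sub by (intro permutes_compose p) auto
  moreover have "evenperm y"
    unfolding y_def
    using d parity
    by (simp add: evenperm_comp evenperm_cycle_of_list permutation_compose permutation_of_cycle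
        del: cycle_of_list.simps)
  ultimately show ?thesis
    by (simp add: alt_group_carrier)
qed

lemma three_cycle_power: "\<exists>k. y ^^ k = cycle_of_list [a, b, c]"
proof -
  let ?C = "cycle_of_list [a, b, c]" and ?Z = "cycle_of_list M \<circ> cycle_of_list D"
  have d: "distinct [a, b, c]" "distinct M" "distinct D"
    using dist by auto
  have comm: "cycle_of_list p \<circ> cycle_of_list q = cycle_of_list q \<circ> cycle_of_list p"
    if "distinct p" "distinct q" "set p \<inter> set q = {}" for p q :: "nat list"
    using cycles_commute[OF that] .
  have CM: "?C \<circ> cycle_of_list M = cycle_of_list M \<circ> ?C"
    and CD: "?C \<circ> cycle_of_list D = cycle_of_list D \<circ> ?C"
    and MD: "cycle_of_list M \<circ> cycle_of_list D = cycle_of_list D \<circ> cycle_of_list M"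
    using dist by (intro comm; auto)+
  have CZ: "?C \<circ> ?Z = ?Z \<circ> ?C"
    using CM CD by (metis comp_assoc)
  have fp: "(g \<circ> h) ^^ k = g ^^ k \<circ> h ^^ k" if "g \<circ> h = h \<circ> g" for g h :: "nat \<Rightarrow> nat" and k
  proof (induction k)
    case (Suc k)
    have "h \<circ> g ^^ k = g ^^ k \<circ> h" for k
    proof (induction k)
      case (Suc k)
      have "h \<circ> g ^^ Suc k = (h \<circ> g) \<circ> g ^^ k"
        by (simp add: comp_assoc)
      also have "\<dots> = g \<circ> (h \<circ> g ^^ k)"
        by (simp only: that[symmetric] comp_assoc)
      also have "\<dots> = g ^^ Suc k \<circ> h"
        by (simp only: Suc funpow.simps(2) comp_assoc)
      finally show ?case .
    qed simp
    then have "g \<circ> (h \<circ> g ^^ k) \<circ> h ^^ k = g ^^ Suc k \<circ> h ^^ Suc k"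
      by (simp only: funpow.simps(2) comp_assoc)
    then show ?case
      by (simp only: funpow.simps(2) Suc comp_assoc)
  qed simp
  \<comment> \<open>an exponent that is a multiple of the length of \<open>M\<close> and congruent to 1 modulo 3\<close>
  obtain j where j: "(length M * j) mod 3 = 1"
  proof -
    have "length M mod 3 = 1 \<or> length M mod 3 = 2"
      using ndvd by presburger
    then have "(length M * 1) mod 3 = 1 \<or> (length M * 2) mod 3 = 1"
      by presburger
    then show ?thesis using that by blast
  qed
  let ?k = "length M * j"
  have "cycle_of_list D ^^ ?k = id"
    using dvd cycle_of_list_funpow_length[OF d(3), of ?k] by (auto simp flip: id_def)
  then have "?Z ^^ ?k = id"
    using fp[OF MD] cycle_of_list_funpow_length[OF d(2), of ?k] by simp
  moreover have "?C ^^ ?k = ?C"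
  proof -
    have "?k = 3 * (?k div 3) + 1"
      using j by presburger
    then have "?C ^^ ?k = ?C ^^ (3 * (?k div 3)) \<circ> ?C"
      by (metis Suc_eq_plus1 funpow_Suc_right)
    moreover have "length [a, b, c] dvd 3 * (?k div 3)"
      by (metis dvd_triv_left length_Cons list.size(3) numeral_3_eq_3)
    ultimately show ?thesis
      using cycle_of_list_funpow_length[OF d(1)] by (metis id_comp)
  qed
  ultimately have "y ^^ ?k = ?C"
    unfolding y_def using fp[OF CZ] by (simp del: cycle_of_list.simps)
  then show ?thesis by blast
qed

end


locale partner_in_subgroup = three_cycle_partner n a b c M D y + alt_subgroup n K
  for n a b c M D y K +
  assumes y_in: "y \<in> K"
begin

lemma three_points_linked: "{a, b, c} \<subseteq> link_class a"
proof -
  obtain k where "y ^^ k = cycle_of_list [a, b, c]"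
    using three_cycle_power by blast
  then have "cycle_of_list [a, b, c] \<in> K"
    using funpow_closed[OF y_in] by metis
  moreover have "distinct [a, b, c]"
    using dist by simp
  ultimately show ?thesis
    using linkedI_three_cycle by blast
qed

lemma class_three: "3 \<le> card (link_class a)"
proof -
  have "card {a, b, c} = 3"
    using dist by simp
  moreover have "finite (link_class a)"
    using link_class_subset[of a] sub finite_subset by auto
  ultimately show ?thesis
    using three_points_linked card_mono by metis
qed

lemma y_stable: "u \<in> link_class a \<Longrightarrow> y u \<in> link_class a"
  using link_class_stable[OF y_in, of a a] three_points_linked y_simps(1) by auto

text \<open>A class preserved by \<open>y\<close> that meets the orbit \<open>M\<close> contains all of it.\<close>

lemma M_absorbed_by:
  assumes "u \<in> link_class v" and "y u \<in> link_class v" and "s \<in> set M" and "s \<in> link_class v"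
  shows "set M \<subseteq> link_class v"
  using link_class_absorbs_cycle[OF y_in _ y_simps(4) assms] dist by simp

lemma M_absorbed: "s \<in> set M \<Longrightarrow> s \<in> link_class a \<Longrightarrow> set M \<subseteq> link_class a"
  using M_absorbed_by[of a a s] y_stable link_class_self by blast

lemma card_class_on_M:
  assumes "s \<in> set M" and "card (link_class s) = k" and "t \<in> set M"
  shows "card (link_class t) = k"
proof (rule cycle_orbit_induct[of M y "\<lambda>u. card (link_class u) = k" s])
  show "y u = cycle_of_list M u" if "u \<in> set M" for u
    using that by (rule y_simps(4))
  show "card (link_class (y u)) = k" if "card (link_class u) = k" for u
    using that card_link_class_image[OF y_in] by simp
qed (use assms dist in auto)

lemma card_class_on_three: "u \<in> {a, b, c} \<Longrightarrow> card (link_class u) = card (link_class a)"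
  using three_points_linked link_class_eq by (metis subsetD)

text \<open>The class of \<open>a\<close> contains all points or only \<open>a\<close>, \<open>b\<close>, \<open>c\<close>. In the second case the step from \<open>a\<close>
  to \<open>s\<close> carries the class size 3 over to \<open>M\<close>, and 3 would divide \<open>n\<close>.\<close>

lemma linked_two_orbits:
  assumes points: "{1..n} = {a, b, c} \<union> set M"
    and x: "x \<in> K" "x a = s" "s \<in> set M" and n: "\<not> 3 dvd n"
  shows "{1..n} \<subseteq> link_class a"
proof (cases "set M \<inter> link_class a = {}")
  case True
  have "link_class a \<subseteq> {1..n}"
    using link_class_subset[of a] sub by auto
  then have "link_class a = {a, b, c}"
    using True three_points_linked points by auto
  then have card_a: "card (link_class a) = 3"
    using dist by simp
  then have "card (link_class s) = 3"
    using card_link_class_image[OF x(1), of a] x(2) by simp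
  then have "card (link_class u) = 3" if "u \<in> {1..n}" for u
    using that card_class_on_M[OF x(3)] card_class_on_three card_a points by (metis UnE)
  then have "3 dvd n"
    using card_link_class_dvd by blast
  then show ?thesis
    using n by simp
next
  case False
  then show ?thesis
    using M_absorbed three_points_linked points by blast
qed

text \<open>Let \<open>B\<close> be the class of \<open>a\<close>. If \<open>f \<in> B\<close>, then \<open>x\<close> maps \<open>f\<close> to \<open>a\<close> and preserves \<open>B\<close>, so that \<open>B\<close>
  reaches \<open>s\<close> and swallows \<open>M\<close>. Otherwise the class of \<open>f\<close> is mapped onto \<open>B\<close> by \<open>x\<close> and is preserved
  by \<open>y\<close>; it has more than two points, hence it contains \<open>M\<close>. Then \<open>B\<close> is \<open>{a, b, c}\<close> and
  comparing sizes gives \<open>|M| + 1 = 3\<close>.\<close>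

lemma linked_with_fixed_point:
  assumes points: "{1..n} = {a, b, c, f} \<union> set M" and f: "f \<notin> {a, b, c} \<union> set M \<union> set D"
    and x: "x \<in> K" "x f = a" "w \<in> {a, b, c}" "x w = s" "s \<in> set M" and n: "length M \<noteq> 2"
  shows "{1..n} \<subseteq> link_class a"
proof -
  have yf: "y f = f"
    using f y_simps(6)[of f] by auto
  have B_sub: "link_class a \<subseteq> {1..n}" and F_sub: "link_class f \<subseteq> {1..n}"
    using link_class_subset points by blast+
  show ?thesis
  proof (cases "f \<in> link_class a")
    case True
    then have "s \<in> link_class a"
      using link_class_stable[OF x(1), of f a w] x link_class_self three_points_linked by auto
    then show ?thesis
      using M_absorbed[OF x(5)] three_points_linked points True by auto
  next
    case False
    have disj: "link_class f \<inter> link_class a = {}"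
      using False link_class_eq link_class_self by blast
    have card_eq: "card (link_class f) = card (link_class a)"
      using card_link_class_image[OF x(1), of f] x(2) by simp
    have "\<not> link_class f \<subseteq> {f}"
      using card_eq class_three card_mono[of "{f}" "link_class f"] by auto
    then obtain t where t: "t \<in> set M" "t \<in> link_class f"
      using F_sub points disj three_points_linked by blast
    then have M: "set M \<subseteq> link_class f"
      using M_absorbed_by[of f f t] yf link_class_self by simp
    have "link_class a = {a, b, c}"
      using B_sub points M disj False three_points_linked by blast
    moreover have "link_class f = insert f (set M)"
      using F_sub points M disj three_points_linked link_class_self by blast
    moreover have "card (set M) = length M"
      using dist distinct_card by auto
    ultimately have "Suc (length M) = 3"
      using card_eq f dist by simp
    then show ?thesis
      using n by simp
  qed
qed

text \<open>If \<open>d\<close> lies in the class \<open>B\<close> of \<open>a\<close>, then \<open>x\<close> preserves \<open>B\<close>, which therefore contains \<open>s\<close>, and \<open>e\<close> is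
  the image of \<open>d\<close> under \<open>y\<close>. Otherwise \<open>M\<close> cannot be in \<open>B\<close>, since this would leave only two
  points for the class of \<open>d\<close>, which is as large as \<open>B\<close>. Thus \<open>B\<close> has three points; as \<open>x\<close> and \<open>y\<close>
  connect all points, every class has three points, and 3 would divide \<open>n\<close>.\<close>

lemma linked_with_transposition:
  assumes points: "{1..n} = {a, b, c, d, e} \<union> set M" and D: "D = [d, e]"
    and x: "x \<in> K" "x a = d" "w \<in> {b, d}" "x w = s" "s \<in> set M" and n: "\<not> 3 dvd n"
  shows "{1..n} \<subseteq> link_class a"
proof -
  have yd: "y d = e" "y e = d"
    using y_simps(5)[of d] y_simps(5)[of e] D by auto
  have B_sub: "link_class a \<subseteq> {1..n}"
    using link_class_subset[of a] sub points by auto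
  have card_d: "card (link_class d) = card (link_class a)"
    using card_link_class_image[OF x(1), of a] x(2) by simp
  show ?thesis
  proof (cases "d \<in> link_class a")
    case True
    then have "s \<in> link_class a"
      using link_class_stable[OF x(1), of a a w] x link_class_self three_points_linked by auto
    moreover have "e \<in> link_class a"
      using y_stable[OF True] yd by simp
    ultimately show ?thesis
      using M_absorbed[OF x(5)] three_points_linked points True by auto
  next
    case False
    then have e: "e \<notin> link_class a"
      using y_stable[of e] yd by auto
    have disj: "link_class d \<inter> link_class a = {}"
      using False link_class_eq link_class_self by blast
    have "\<not> set M \<subseteq> link_class a"
    proof
      assume "set M \<subseteq> link_class a"
      then have "link_class d \<subseteq> {d, e}"
        using link_class_subset[of d] disj three_points_linked points by blast
      then have "card (link_class d) \<le> card {d, e}"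
        by (intro card_mono) auto
      moreover have "card {d, e} \<le> 2"
        by (simp add: card_insert_if)
      ultimately show False
        using card_d class_three by linarith
    qed
    then have "link_class a = {a, b, c}"
      using M_absorbed B_sub points False e three_points_linked by blast
    then have card_a: "card (link_class a) = 3"
      using dist by simp
    have "card (link_class w) = 3"
      using x(3) card_d card_a card_class_on_three[of b] by auto
    then have "card (link_class s) = 3"
      using card_link_class_image[OF x(1), of w] x(4) by simp
    then have card_M: "card (link_class u) = 3" if "u \<in> set M" for u
      using that card_class_on_M[OF x(5)] by blast
    have card_e: "card (link_class e) = 3"
      using card_link_class_image[OF y_in, of d] yd card_d card_a by simp
    have "card (link_class u) = 3" if "u \<in> {1..n}" for u
    proof -
      have "u \<in> {a, b, c, d, e} \<union> set M"
        using that unfolding points .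
      then show ?thesis
        using card_M card_e card_d card_a card_class_on_three[of u] by auto
    qed
    then have "3 dvd n"
      using card_link_class_dvd by blast
    then show ?thesis
      using n by simp
  qed
qed

text \<open>The points \<open>v\<close> and \<open>w\<close> are placeholders for two ways in which \<open>x\<close> can join the orbits \<open>{f}\<close>,
  \<open>{a, b, c}\<close>, \<open>{g}\<close> and \<open>M\<close>: by a path through one cycle of \<open>x\<close>, or by steps in several cycles.
  If \<open>f\<close> is in the class \<open>B\<close> of \<open>a\<close>, then \<open>x\<close> preserves \<open>B\<close>, which picks up \<open>g\<close> and then \<open>s\<close>.
  Otherwise the class of \<open>f\<close> is as large as \<open>B\<close> and preserved by \<open>y\<close>, so it contains \<open>M\<close>. Equal
  sizes then leave two possibilities: \<open>|M| = 3\<close>, with \<open>g \<in> B\<close>, or \<open>|M| = 1\<close>, with \<open>f\<close> and \<open>g\<close> in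
  one class, which \<open>x\<close> maps onto \<open>{a, b, c}\<close>. The last two hypotheses exclude them.\<close>

lemma linked_with_two_fixed_points:
  assumes points: "{1..n} = {a, b, c, f, g} \<union> set M"
    and fg: "f \<notin> {a, b, c} \<union> set M \<union> set D" "g \<notin> {a, b, c} \<union> set M \<union> set D" "f \<noteq> g"
    and x: "x \<in> K" "x f = a" "v \<in> {a, b}" "x v = g" "w \<in> {a, b, c, g}" "x w = s" "s \<in> set M"
    and n: "length M \<noteq> 3" "length M = 1 \<Longrightarrow> x g \<notin> {a, b, c}"
  shows "{1..n} \<subseteq> link_class a"
proof -
  have yf: "y f = f" and yg: "y g = g"
    using fg y_simps(6)[of f] y_simps(6)[of g] by auto
  have B_sub: "link_class a \<subseteq> {1..n}" and F_sub: "link_class f \<subseteq> {1..n}"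
    and G_sub: "link_class g \<subseteq> {1..n}"
    using link_class_subset points by blast+
  have card_M: "card (set M) = length M"
    using dist distinct_card by auto
  show ?thesis
  proof (cases "f \<in> link_class a")
    case True
    then have stable: "x u \<in> link_class a" if "u \<in> link_class a" for u
      using link_class_stable[OF x(1), of f a u] x(2) link_class_self that by auto
    have "g \<in> link_class a"
      using stable[of v] x(3,4) three_points_linked by auto
    moreover from this have "s \<in> link_class a"
      using stable[of w] x(5,6) three_points_linked by auto
    ultimately show ?thesis
      using M_absorbed[OF x(7)] three_points_linked points True by auto
  next
    case False
    have disj: "link_class f \<inter> link_class a = {}"
      using False link_class_eq link_class_self by blast
    have image: "x ` link_class f = link_class a"
      using link_class_image[OF x(1), of f] x(2) by simp
    have card_f: "card (link_class f) = card (link_class a)"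
      using card_link_class_image[OF x(1), of f] x(2) by simp
    have card_g: "card (link_class g) = card (link_class a)"
      using card_link_class_image[OF x(1), of v] card_class_on_three[of v] x(3,4) by auto
    have small: "\<not> C \<subseteq> {f, g}" if "card C = card (link_class a)" for C
      using that class_three card_mono[of "{f, g}" C] fg(3) by auto
    obtain t where t: "t \<in> set M" "t \<in> link_class f"
      using small[OF card_f] F_sub points disj three_points_linked by blast
    then have M: "set M \<subseteq> link_class f"
      using M_absorbed_by[of f f t] yf link_class_self by simp
    show ?thesis
    proof (cases "g \<in> link_class a")
      case True
      then have "link_class a = {a, b, c, g}"
        using B_sub points M disj False three_points_linked by blast
      moreover have "link_class f = insert f (set M)"
        using F_sub points M disj three_points_linked link_class_self True by blast
      ultimately have "Suc (length M) = 4"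
        using card_f fg dist card_M by (auto simp: card_insert_if)
      then show ?thesis
        using n by simp
    next
      case g: False
      have B: "link_class a = {a, b, c}"
        using B_sub points M disj False g three_points_linked by blast
      have disj_g: "link_class g \<inter> link_class a = {}"
        using g link_class_eq link_class_self by blast
      then obtain t' where "t' \<in> set M" "t' \<in> link_class g"
        using small[OF card_g] G_sub points three_points_linked by blast
      then have "set M \<subseteq> link_class g"
        using M_absorbed_by[of g g t'] yg link_class_self by simp
      then have "link_class g = link_class f"
        using M t(1) link_class_eq by blast
      then have "{f, g} \<subseteq> link_class f"
        using link_class_self[of f] link_class_self[of g] by simp
      moreover have "link_class f \<subseteq> insert f (insert g (set M))"
        using F_sub points disj three_points_linked by blast
      ultimately have "link_class f = insert f (insert g (set M))"
        using M by blast
      then have "g \<in> link_class f" "Suc (Suc (length M)) = 3"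
        using card_f fg dist card_M B by simp_all
      then have "x g \<in> {a, b, c}" "length M = 1"
        using image B by auto
      then show ?thesis
        using n(2) by blast
    qed
  qed
qed

end

section \<open>Placing the orbits of a partner\<close>

lemma ex_point_outside:
  assumes "length l < n"
  shows "\<exists>u. u \<in> {1..n} \<and> u \<notin> set l"
proof -
  have "card (set l) < card {1..n}"
    using card_length[of l] assms by simp
  then have "\<not> {1..n} \<subseteq> set l"
    using card_mono[of "set l" "{1..n}"] by auto
  then show ?thesis
    by blast
qed

lemma ex_complement_list:
  assumes "distinct l" and "set l \<subseteq> {1..n}"
  shows "\<exists>M. distinct M \<and> set M = {1..n} - set l \<and> length M = n - length l
    \<and> {1..n} = set l \<union> set M"
proof -
  obtain M where M: "set M = {1..n} - set l" "distinct M"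
    using finite_distinct_list[of "{1..n} - set l"] by auto
  have "length M = card ({1..n} - set l)"
    using M distinct_card by metis
  also have "\<dots> = n - length l"
    using card_Diff_subset[of "set l" "{1..n}"] assms distinct_card[of l] by simp
  finally have len: "length M = n - length l" .
  have "{1..n} = set l \<union> set M"
    unfolding M(1) using assms(2) by blast
  then show ?thesis
    using M len by blast
qed

text \<open>The long cycle has length \<open>n - 3\<close>, which is odd and prime to 3.\<close>

lemma partner_two_orbits:
  assumes n: "even n" "\<not> 3 dvd n" "4 \<le> n" and x: "x a = s" "distinct [a, s]" "{a, s} \<subseteq> {1..n}"
  shows "\<exists>y. generates_with n x y"
proof -
  obtain b where b: "b \<in> {1..n}" "b \<notin> set [a, s]"
    using ex_point_outside[of "[a, s]" n] n by auto
  obtain c where c: "c \<in> {1..n}" "c \<notin> set [a, s, b]"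
    using ex_point_outside[of "[a, s, b]" n] n by auto
  have l: "distinct [a, b, c]" "set [a, b, c] \<subseteq> {1..n}"
    using x b c by auto
  obtain M where M: "distinct M" "set M = {1..n} - set [a, b, c]" "length M = n - length [a, b, c]"
      "{1..n} = set [a, b, c] \<union> set M"
    using ex_complement_list[OF l] by blast
  have len_M: "length M = n - 3"
    using M(3) by simp
  define y where "y = cycle_of_list [a, b, c] \<circ> (cycle_of_list M \<circ> cycle_of_list [])"
  interpret three_cycle_partner n a b c M "[]" y
  proof
    show "\<not> 3 dvd length M"
      using len_M n by presburger
    show "distinct ([a, b, c] @ M @ [])" "set ([a, b, c] @ M @ []) \<subseteq> {1..n}"
      using x b c M(1,2) by auto
    show "y = cycle_of_list [a, b, c] \<circ> (cycle_of_list M \<circ> cycle_of_list [])"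
      by (rule y_def)
    show "even ((length M - 1) + (length ([] :: nat list) - 1))"
      using len_M n by simp
  qed simp
  have "generates_with n x y"
  proof (rule generates_withI[OF y_in_alt])
    fix K
    assume K: "alt_subgroup n K" and xK: "x \<in> K" and yK: "y \<in> K"
    interpret alt_subgroup n K by (rule K)
    interpret partner_in_subgroup n a b c M "[]" y K
      by unfold_locales (rule yK)
    have sM: "s \<in> set M"
      using x(2,3) b(2) c(2) M(2) by simp
    have all: "{1..n} = {a, b, c} \<union> set M"
      using M(4) by (simp add: insert_commute)
    show "\<exists>a. {1..n} \<subseteq> link_class a"
      by (rule exI, rule linked_two_orbits[OF all xK x(1) sM n(2)])
  qed
  then show ?thesis by blast
qed

text \<open>For odd \<open>n\<close> one point is left fixed to make \<open>n - 4\<close> odd; this length is prime to 3 unless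
  \<open>n mod 3 = 1\<close>. The point \<open>w\<close> covers both shapes of \<open>x\<close>: a path of two steps in one cycle of \<open>x\<close>
  (\<open>w = a\<close>), or one step in each of two cycles (\<open>w = b\<close>).\<close>

lemma partner_fixed_point:
  assumes n: "odd n" "n mod 3 \<noteq> 1" "5 \<le> n"
    and x: "x f = a" "w = a \<or> w = b" "x w = s"
    and points: "distinct [f, a, b, s]" "{f, a, b, s} \<subseteq> {1..n}"
  shows "\<exists>y. generates_with n x y"
proof -
  obtain c where c: "c \<in> {1..n}" "c \<notin> set [f, a, b, s]"
    using ex_point_outside[of "[f, a, b, s]" n] n by auto
  have l: "distinct [a, b, c, f]" "set [a, b, c, f] \<subseteq> {1..n}"
    using points c by auto
  obtain M where M: "distinct M" "set M = {1..n} - set [a, b, c, f]" "length M = n - length [a, b, c, f]"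
      "{1..n} = set [a, b, c, f] \<union> set M"
    using ex_complement_list[OF l] by blast
  have len_M: "length M = n - 4"
    using M(3) by simp
  define y where "y = cycle_of_list [a, b, c] \<circ> (cycle_of_list M \<circ> cycle_of_list [])"
  interpret three_cycle_partner n a b c M "[]" y
  proof
    show "\<not> 3 dvd length M"
      using len_M n by presburger
    show "distinct ([a, b, c] @ M @ [])" "set ([a, b, c] @ M @ []) \<subseteq> {1..n}"
      using points c M(1,2) by auto
    show "y = cycle_of_list [a, b, c] \<circ> (cycle_of_list M \<circ> cycle_of_list [])"
      by (rule y_def)
    show "even ((length M - 1) + (length ([] :: nat list) - 1))"
      using len_M n by simp
  qed simp
  have "generates_with n x y"
  proof (rule generates_withI[OF y_in_alt])
    fix K
    assume K: "alt_subgroup n K" and xK: "x \<in> K" and yK: "y \<in> K"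
    interpret alt_subgroup n K by (rule K)
    interpret partner_in_subgroup n a b c M "[]" y K
      by unfold_locales (rule yK)
    have len: "length M \<noteq> 2"
      using len_M n by presburger
    have all: "{1..n} = {a, b, c, f} \<union> set M"
      using M(4) by (simp add: insert_commute)
    have f: "f \<notin> {a, b, c} \<union> set M \<union> set []"
      using l(1) M(2) by simp
    have sM: "s \<in> set M" and w: "w \<in> {a, b, c}"
      using points c(2) M(2) x(2) by auto
    show "\<exists>a. {1..n} \<subseteq> link_class a"
      by (rule exI, rule linked_with_fixed_point[OF all f xK x(1) w x(3) sM len])
  qed
  then show ?thesis by blast
qed

text \<open>In the residue class left over for odd \<open>n\<close>, a transposition \<open>(d e)\<close> corrects the parity of a cycle
  of length \<open>n - 5\<close>, which is even and prime to 3.\<close>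

lemma partner_transposition:
  assumes n: "odd n" "n mod 3 = 1" "7 \<le> n"
    and x: "x a = d" "w = b \<or> w = d" "x w = s"
    and points: "distinct [a, b, d, s]" "{a, b, d, s} \<subseteq> {1..n}"
  shows "\<exists>y. generates_with n x y"
proof -
  obtain c where c: "c \<in> {1..n}" "c \<notin> set [a, b, d, s]"
    using ex_point_outside[of "[a, b, d, s]" n] n by auto
  obtain e where e: "e \<in> {1..n}" "e \<notin> set [a, b, d, s, c]"
    using ex_point_outside[of "[a, b, d, s, c]" n] n by auto
  have l: "distinct [a, b, c, d, e]" "set [a, b, c, d, e] \<subseteq> {1..n}"
    using points c e by auto
  obtain M where M: "distinct M" "set M = {1..n} - set [a, b, c, d, e]" "length M = n - length [a, b, c, d, e]"
      "{1..n} = set [a, b, c, d, e] \<union> set M"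
    using ex_complement_list[OF l] by blast
  have len_M: "length M = n - 5"
    using M(3) by simp
  define y where "y = cycle_of_list [a, b, c] \<circ> (cycle_of_list M \<circ> cycle_of_list [d, e])"
  have "even (length M)" "length M \<noteq> 0"
    using len_M n by presburger+
  interpret three_cycle_partner n a b c M "[d, e]" y
  proof
    show "\<not> 3 dvd length M"
      using len_M n by presburger
    show "even ((length M - 1) + (length [d, e] - 1))"
      using \<open>even (length M)\<close> \<open>length M \<noteq> 0\<close> by simp
    show "distinct ([a, b, c] @ M @ [d, e])" "set ([a, b, c] @ M @ [d, e]) \<subseteq> {1..n}"
      using points c e M(1,2) by auto
    show "y = cycle_of_list [a, b, c] \<circ> (cycle_of_list M \<circ> cycle_of_list [d, e])"
      by (rule y_def)
    show "[d, e] = [] \<or> length [d, e] dvd length M"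
      using \<open>even (length M)\<close> by (simp add: numeral_2_eq_2)
  qed
  have "generates_with n x y"
  proof (rule generates_withI[OF y_in_alt])
    fix K
    assume K: "alt_subgroup n K" and xK: "x \<in> K" and yK: "y \<in> K"
    interpret alt_subgroup n K by (rule K)
    interpret partner_in_subgroup n a b c M "[d, e]" y K
      by unfold_locales (rule yK)
    have ndvd: "\<not> 3 dvd n"
      using n by presburger
    have all: "{1..n} = {a, b, c, d, e} \<union> set M"
      using M(4) by (simp add: insert_commute)
    have sM: "s \<in> set M" and w: "w \<in> {b, d}"
      using points c(2) e(2) M(2) x(2) by auto
    show "\<exists>a. {1..n} \<subseteq> link_class a"
      by (rule exI, rule linked_with_transposition[OF all refl xK x(1) w x(3) sM ndvd])
  qed
  then show ?thesis by blast
qed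

text \<open>If 6 divides \<open>n\<close>, then \<open>n - 3\<close> is a multiple of 3, and with three orbits in all \<open>y\<close> would be odd; two
  fixed points leave a cycle of length \<open>n - 5\<close>, which is odd and prime to 3.\<close>

lemma partner_two_fixed_points:
  assumes n: "even n" "3 dvd n"
    and x: "x f = a" "v \<in> {a, b}" "x v = g" "w \<in> {b, c, g}" "x w = s"
    and points: "distinct [a, b, c, f, g, s]" "{a, b, c, f, g, s} \<subseteq> {1..n}"
    and small: "n = 6 \<Longrightarrow> x g \<notin> {a, b, c}"
  shows "\<exists>y. generates_with n x y"
proof -
  have n6: "6 \<le> n"
    using card_mono[of "{1..n}" "set [a, b, c, f, g, s]"] points(2) distinct_card[OF points(1)]
    by simp
  have l: "distinct [a, b, c, f, g]" "set [a, b, c, f, g] \<subseteq> {1..n}"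
    using points by auto
  obtain M where M: "distinct M" "set M = {1..n} - set [a, b, c, f, g]" "length M = n - length [a, b, c, f, g]"
      "{1..n} = set [a, b, c, f, g] \<union> set M"
    using ex_complement_list[OF l] by blast
  have len_M: "length M = n - 5"
    using M(3) by simp
  define y where "y = cycle_of_list [a, b, c] \<circ> (cycle_of_list M \<circ> cycle_of_list [])"
  interpret three_cycle_partner n a b c M "[]" y
  proof
    show "\<not> 3 dvd length M"
      using len_M n n6 by presburger
    show "distinct ([a, b, c] @ M @ [])" "set ([a, b, c] @ M @ []) \<subseteq> {1..n}"
      using points M(1,2) by auto
    show "y = cycle_of_list [a, b, c] \<circ> (cycle_of_list M \<circ> cycle_of_list [])"
      by (rule y_def)
    show "even ((length M - 1) + (length ([] :: nat list) - 1))"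
      using len_M n n6 by simp
  qed simp
  have "generates_with n x y"
  proof (rule generates_withI[OF y_in_alt])
    fix K
    assume K: "alt_subgroup n K" and xK: "x \<in> K" and yK: "y \<in> K"
    interpret alt_subgroup n K by (rule K)
    interpret partner_in_subgroup n a b c M "[]" y K
      by unfold_locales (rule yK)
    have len: "length M \<noteq> 3"
      using len_M n by presburger
    have len1: "x g \<notin> {a, b, c}" if "length M = 1"
      using small that len_M by simp
    have all: "{1..n} = {a, b, c, f, g} \<union> set M"
      using M(4) by (simp add: insert_commute)
    have f: "f \<notin> {a, b, c} \<union> set M \<union> set []" and g: "g \<notin> {a, b, c} \<union> set M \<union> set []"
      and fg: "f \<noteq> g"
      using l(1) M(2) by auto
    have sM: "s \<in> set M" and w: "w \<in> {a, b, c, g}"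
      using points M(2) x(4) by auto
    show "\<exists>a. {1..n} \<subseteq> link_class a"
      by (rule exI, rule linked_with_two_fixed_points[OF all f g fg xK x(1,2,3) w x(5) sM len len1])
  qed
  then show ?thesis by blast
qed


section \<open>Partners for 3-cycles and double transpositions\<close>

text \<open>The 3-cycle \<open>x\<close> links \<open>p\<close> with a point of a cycle \<open>y\<close> that fixes exactly \<open>p\<close>, so the class of \<open>p\<close>
  is preserved by \<open>y\<close> and contains everything.\<close>

lemma partner_three_cycle:
  assumes n: "even n" and x: "x = cycle_of_list [p, q, r]" "distinct [p, q, r]" "{p, q, r} \<subseteq> {1..n}"
  shows "\<exists>y. generates_with n x y"
proof -
  have l: "distinct [p]" "set [p] \<subseteq> {1..n}"
    using x(3) by auto
  obtain M where M: "distinct M" "set M = {1..n} - set [p]" "length M = n - length [p]"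
      "{1..n} = set [p] \<union> set M"
    using ex_complement_list[OF l] by blast
  define y where "y = cycle_of_list M"
  have "odd (length M)"
    using M(3) n x(3) by simp
  then have y: "y \<in> carrier (alt_group n)"
    unfolding y_def using M(2) by (intro cycle_in_alt_group[OF M(1)]) auto
  have "p \<notin> set M"
    using M(2) by simp
  then have yp: "y p = p"
    unfolding y_def by (rule id_outside_supp)
  have "generates_with n x y"
  proof (rule generates_withI[OF y])
    fix K
    assume K: "alt_subgroup n K" and xK: "x \<in> K" and yK: "y \<in> K"
    interpret alt_subgroup n K by (rule K)
    have T: "{p, q, r} \<subseteq> link_class p"
      using linkedI_three_cycle x xK by blast
    have qM: "q \<in> set M"
      using M(2) x by auto
    have "y u = cycle_of_list M u" for u
      by (simp add: y_def)
    then have "set M \<subseteq> link_class p"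
      using link_class_absorbs_cycle[OF yK M(1) _ link_class_self _ qM] yp T link_class_self by auto
    then have "{1..n} \<subseteq> link_class p"
      unfolding M(4) using T by simp
    then show "\<exists>a. {1..n} \<subseteq> link_class a"
      by blast
  qed
  then show ?thesis by blast
qed

text \<open>The product is \<open>(p q' q)(r s)(r' s')\<close>.\<close>

lemma square_of_overlapping_double_transpositions:
  assumes "distinct [p, q, r, s, q', r', s']"
  shows "((transpose p q \<circ> transpose r s) \<circ> (transpose p q' \<circ> transpose r' s')) ^^ 2
    = cycle_of_list [p, q, q']"
proof
  fix u
  consider "u \<in> {p, q, r, s, q', r', s'}" | "u \<notin> {p, q, r, s, q', r', s'}"
    by blast
  then show "(((transpose p q \<circ> transpose r s) \<circ> (transpose p q' \<circ> transpose r' s')) ^^ 2) u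
    = cycle_of_list [p, q, q'] u"
  proof cases
    case 1
    then show ?thesis
      using assms by (auto simp: numeral_2_eq_2 transpose_apply_other)
  next
    case 2
    then show ?thesis
      by (simp add: numeral_2_eq_2 transpose_apply_other)
  qed
qed

lemma conj_transposition:
  assumes "bij g"
  shows "g \<circ> transpose u v \<circ> inv' g = transpose (g u) (g v)"
proof -
  have "transpose (g u) (g v) \<circ> g = g \<circ> transpose u v"
    using transpose_comp_eq[OF assms, of "g u" "g v"] bij_is_inj[OF assms] by (simp add: inv_f_f)
  then show ?thesis
    using surj_iff[of g] bij_is_surj[OF assms] by (metis comp_assoc comp_id)
qed

lemma eq_three_cycleI:
  assumes d: "distinct [p, q, r]" and x: "x p = q" "x q = r" "x r = p"
    and fixed: "\<And>u. u \<notin> {p, q, r} \<Longrightarrow> x u = u"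
  shows "x = cycle_of_list [p, q, r]"
proof
  fix u
  show "x u = cycle_of_list [p, q, r] u"
    using d x fixed[of u] by (cases "u \<in> {p, q, r}") (auto simp: transpose_def)
qed

text \<open>The cycle \<open>y\<close> fixes \<open>p\<close> and starts with \<open>q, q', r, r', s, s'\<close>, so that \<open>x = (p q)(r s)\<close> and its
  conjugate \<open>(p q')(r' s')\<close> by \<open>y\<close> both move \<open>p\<close>, but no other point in common. The square of their product is
  a 3-cycle that links \<open>p\<close> to \<open>q\<close>. Seven different points are needed for this.\<close>

lemma partner_double_transposition:
  assumes n: "even n" "8 \<le> n" and x: "x = transpose p q \<circ> transpose r s"
    and points: "distinct [p, q, r, s]" "{p, q, r, s} \<subseteq> {1..n}"
  shows "\<exists>y. generates_with n x y"
proof -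
  obtain q' where q': "q' \<in> {1..n}" "q' \<notin> set [p, q, r, s]"
    using ex_point_outside[of "[p, q, r, s]" n] n by auto
  obtain r' where r': "r' \<in> {1..n}" "r' \<notin> set [p, q, r, s, q']"
    using ex_point_outside[of "[p, q, r, s, q']" n] n by auto
  obtain s' where s': "s' \<in> {1..n}" "s' \<notin> set [p, q, r, s, q', r']"
    using ex_point_outside[of "[p, q, r, s, q', r']" n] n by auto
  have l: "distinct [p, q, q', r, r', s, s']" "set [p, q, q', r, r', s, s'] \<subseteq> {1..n}"
    using points q' r' s' by auto
  obtain L where L: "distinct L" "set L = {1..n} - set [p, q, q', r, r', s, s']"
      "length L = n - length [p, q, q', r, r', s, s']"
      "{1..n} = set [p, q, q', r, r', s, s'] \<union> set L"
    using ex_complement_list[OF l] by blast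
  define M where "M = [q, q', r, r', s, s'] @ L"
  define y where "y = cycle_of_list M"
  have M: "distinct M"
    unfolding M_def using l(1) L(1,2) by auto
  have all: "{1..n} = insert p (set M)"
    unfolding L(4) M_def by auto
  have "odd (length M)"
    using L(3) n M_def by simp
  then have y: "y \<in> carrier (alt_group n)"
    unfolding y_def using all by (intro cycle_in_alt_group[OF M]) auto
  have "p \<notin> set M"
    unfolding M_def using l(1) L(2) by auto
  then have yp: "y p = p"
    unfolding y_def by (rule id_outside_supp)
  have "map y M = rotate1 M"
    unfolding y_def using cyclic_rotation[OF M, of 1] by simp
  then have y_vals: "y q = q'" "y r = r'" "y s = s'"
    unfolding M_def by simp_all
  have "generates_with n x y"
  proof (rule generates_withI[OF y])
    fix K
    assume K: "alt_subgroup n K" and xK: "x \<in> K" and yK: "y \<in> K"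
    interpret alt_subgroup n K by (rule K)
    have "y \<circ> x \<circ> inv' y = (y \<circ> transpose p q \<circ> inv' y) \<circ> (y \<circ> transpose r s \<circ> inv' y)"
      unfolding x using bij_is_inj[OF bij[OF yK]] by (simp add: fun_eq_iff)
    also have "\<dots> = transpose p q' \<circ> transpose r' s'"
      using conj_transposition[OF bij[OF yK]] yp y_vals by simp
    finally have "transpose p q' \<circ> transpose r' s' \<in> K"
      using comp_closed[OF comp_closed[OF yK xK] inv_closed[OF yK]] by simp
    then have "(x \<circ> (transpose p q' \<circ> transpose r' s')) ^^ 2 \<in> K"
      using funpow_closed comp_closed xK by blast
    moreover have "distinct [p, q, r, s, q', r', s']"
      using l(1) by auto
    ultimately have "cycle_of_list [p, q, q'] \<in> K"
      using square_of_overlapping_double_transpositions unfolding x by metis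
    then have T: "{p, q, q'} \<subseteq> link_class p"
      using linkedI_three_cycle l(1) by simp
    have qM: "q \<in> set M"
      unfolding M_def by simp
    have "y u = cycle_of_list M u" for u
      by (simp add: y_def)
    then have "set M \<subseteq> link_class p"
      using link_class_absorbs_cycle[OF yK M _ link_class_self _ qM] yp T link_class_self by auto
    then have "{1..n} \<subseteq> link_class p"
      unfolding all using T by simp
    then show "\<exists>a. {1..n} \<subseteq> link_class a"
      by blast
  qed
  then show ?thesis by blast
qed

text \<open>On six points there is no room for disjoint shifts of \<open>r\<close> and \<open>s\<close>. For an unfavourable position of
  \<open>r\<close> and \<open>s\<close> on a 5-cycle that fixes \<open>p\<close>, the generated group is only the 2-transitive copy of \<open>A\<^sub>5\<close>
  in \<open>A\<^sub>6\<close>. If \<open>q, r, s\<close> are consecutive, the word \<open>x y x y\<^sup>-\<^sup>1 x y y\<close> is a 3-cycle.\<close>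

lemma partner_double_transposition_six:
  assumes x: "x = transpose p q \<circ> transpose r s"
    and points: "distinct [p, q, r, s]" "{p, q, r, s} \<subseteq> {1..6}"
  shows "\<exists>y. generates_with 6 x y"
proof -
  have l: "distinct [p, q, r, s]" "set [p, q, r, s] \<subseteq> {1..6}"
    using points by auto
  obtain L where L: "distinct L" "set L = {1..6} - set [p, q, r, s]"
      "length L = 6 - length [p, q, r, s]" "{1..6} = set [p, q, r, s] \<union> set L"
    using ex_complement_list[OF l] by blast
  obtain t u where tu: "L = [t, u]"
    using L(3) by (auto simp: length_Suc_conv numeral_eq_Suc)
  have d: "distinct [p, q, r, s, t, u]"
    using L(1,2) points(1) unfolding tu by auto
  have all: "{1..6} = {p, q, r, s, t, u}"
    unfolding L(4) tu by auto
  define y where "y = cycle_of_list [q, r, s, t, u]"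
  have yset: "set [q, r, s, t, u] \<subseteq> {1..6}"
    unfolding all by auto
  have y: "y \<in> carrier (alt_group 6)"
    unfolding y_def using d yset by (intro cycle_in_alt_group) auto
  have yv: "y p = p" "y q = r" "y r = s" "y s = t" "y t = u" "y u = q"
    and yid: "v \<notin> {p, q, r, s, t, u} \<Longrightarrow> y v = v" for v
    unfolding y_def using d by (auto simp: transpose_def)
  have xv: "x p = q" "x q = p" "x r = s" "x s = r" "x t = t" "x u = u"
    and xid: "v \<notin> {p, q, r, s, t, u} \<Longrightarrow> x v = v" for v
    unfolding x using d by (auto simp: transpose_def)
  have "generates_with 6 x y"
  proof (rule generates_withI[OF y])
    fix K
    assume K: "alt_subgroup 6 K" and xK: "x \<in> K" and yK: "y \<in> K"
    interpret alt_subgroup 6 K by (rule K)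
    have inj: "inj y"
      using bij_is_inj[OF bij[OF yK]] .
    have yinv: "inv' y p = p" "inv' y q = u" "inv' y r = q" "inv' y s = r" "inv' y t = s" "inv' y u = t"
      and yinv_id: "v \<notin> {p, q, r, s, t, u} \<Longrightarrow> inv' y v = v" for v
      using yv yid inj by (auto intro: inv_f_eq)
    have "x \<circ> y \<circ> x \<circ> inv' y \<circ> x \<circ> y \<circ> y = cycle_of_list [s, u, t]"
    proof
      fix v
      have c: "cycle_of_list [s, u, t] s = u" "cycle_of_list [s, u, t] u = t"
        "cycle_of_list [s, u, t] t = s"
        using d by (auto simp: transpose_def)
      have c_id: "cycle_of_list [s, u, t] v = v" if "v \<notin> {s, t, u}" for v
        using that id_outside_supp[of v "[s, u, t]"] by auto
      consider "v = p" | "v = q" | "v = r" | "v = s" | "v = t" | "v = u" | "v \<notin> {p, q, r, s, t, u}"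
        by blast
      then show "(x \<circ> y \<circ> x \<circ> inv' y \<circ> x \<circ> y \<circ> y) v = cycle_of_list [s, u, t] v"
        by cases (use d in \<open>simp_all add: xv yv yinv xid yid yinv_id c c_id del: cycle_of_list.simps\<close>)
    qed
    moreover have "x \<circ> y \<circ> x \<circ> inv' y \<circ> x \<circ> y \<circ> y \<in> K"
      by (intro comp_closed inv_closed xK yK)
    ultimately have "{s, u, t} \<subseteq> link_class s"
      using linkedI_three_cycle d by auto
    then have T: "s \<in> link_class s" "t \<in> link_class s" "u \<in> link_class s"
      by auto
    have ystable: "y v \<in> link_class s" if "v \<in> link_class s" for v
      using link_class_stable[OF yK T(1) _ that] T(2) yv(4) by simp
    have q: "q \<in> link_class s"
      using ystable[OF T(3)] yv(6) by simp
    have r: "r \<in> link_class s"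
      using ystable[OF q] yv(2) by simp
    have "x q \<in> link_class s"
      using link_class_stable[OF xK r _ q] xv(3) T(1) by simp
    then have "p \<in> link_class s"
      using xv(2) by simp
    then have "{1..6} \<subseteq> link_class s"
      unfolding all using T q r by simp
    then show "\<exists>a. {1..6} \<subseteq> link_class a"
      by blast
  qed
  then show ?thesis by blast
qed

section \<open>Partners for all nonidentity elements\<close>

lemma involution_moves_two_pairs:
  assumes "evenperm x" and inv: "\<And>u. x (x u) = u" and p: "x p \<noteq> p"
  obtains r where "x r \<noteq> r" and "r \<notin> {p, x p}"
proof (rule ccontr)
  assume "\<not> thesis"
  then have other: "x r = r" if "r \<notin> {p, x p}" for r
    using that \<open>\<And>r. x r \<noteq> r \<Longrightarrow> r \<notin> {p, x p} \<Longrightarrow> thesis\<close> by blast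
  have "x = transpose p (x p)"
  proof
    fix u
    show "x u = transpose p (x p) u"
      using other[of u] inv[of p] by (cases "u = p"; cases "u = x p") auto
  qed
  then show False
    using assms(1) p evenperm_swap[of p "x p"] by metis
qed

text \<open>A product of three disjoint transpositions is odd.\<close>

lemma involution_moves_four_pairs:
  assumes "evenperm x" and inv: "\<And>u. x (x u) = u"
    and d: "distinct [p, x p, r, x r, t, x t]"
  obtains v where "x v \<noteq> v" and "v \<notin> {p, x p, r, x r, t, x t}"
proof (rule ccontr)
  assume "\<not> thesis"
  then have other: "x v = v" if "v \<notin> {p, x p, r, x r, t, x t}" for v
    using that \<open>\<And>v. x v \<noteq> v \<Longrightarrow> v \<notin> {p, x p, r, x r, t, x t} \<Longrightarrow> thesis\<close> by blast
  have eq: "x = transpose p (x p) \<circ> (transpose r (x r) \<circ> transpose t (x t))"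
  proof
    fix u
    show "x u = (transpose p (x p) \<circ> (transpose r (x r) \<circ> transpose t (x t))) u"
    proof (cases "u \<in> {p, x p, r, x r, t, x t}")
      case True
      then show ?thesis
        using d inv[of p] inv[of r] inv[of t] by (auto simp: transpose_def)
    next
      case False
      then show ?thesis
        using other[OF False] by simp
    qed
  qed
  have "\<not> evenperm (transpose p (x p) \<circ> (transpose r (x r) \<circ> transpose t (x t)))"
    using d by (simp add: evenperm_comp evenperm_swap permutation_swap_id permutation_compose)
  then show False
    using assms(1) eq by metis
qed

text \<open>If \<open>x\<close> has a cycle of length at least 3, the orbits of \<open>y\<close> are joined along the path \<open>p, q, r\<close> in
  that cycle; if \<open>x\<close> is an involution, along two of its transpositions \<open>(p q)\<close> and \<open>(r s)\<close>. Only
  multiples of 6 need a third step, and thus a distinction of elements that have none.\<close>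

lemma ex_generating_partner:
  assumes x: "x \<in> carrier (alt_group n)" and "x \<noteq> id"
  shows "\<exists>y. generates_with n x y"
proof -
  have perm: "x permutes {1..n}" and even: "evenperm x"
    using x by (simp_all add: alt_group_carrier)
  have inj: "x u = x v \<longleftrightarrow> u = v" for u v
    using permutes_inj[OF perm] by (simp add: inj_eq)
  have moved: "u \<in> {1..n}" "x u \<in> {1..n}" if "x u \<noteq> u" for u
    using that perm permutes_in_image[OF perm] unfolding permutes_def by metis+
  obtain p where p: "x p \<noteq> p"
    using assms(2) by (metis ext id_apply)
  show ?thesis
  proof (cases "\<exists>p. x (x p) \<noteq> p")
    case True
    then obtain p where xxp: "x (x p) \<noteq> p"
      by blast
    define q where "q = x p"
    define r where "r = x q"
    have d: "distinct [p, q, r]"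
      using xxp inj unfolding q_def r_def by auto
    have sub: "{p, q, r} \<subseteq> {1..n}"
      using moved[of p] moved[of q] d unfolding q_def r_def by auto
    then have n3: "3 \<le> n"
      using card_mono[of "{1..n}" "set [p, q, r]"] distinct_card[OF d] by simp
    consider "n = 3" | "4 \<le> n" "even n" "\<not> 3 dvd n" | "5 \<le> n" "odd n" "n mod 3 \<noteq> 1"
      | "7 \<le> n" "odd n" "n mod 3 = 1" | "6 \<le> n" "even n" "3 dvd n"
      using n3 by atomize_elim presburger
    then show ?thesis
    proof cases
      case 1
      have all: "{1..n} = {p, q, r}"
        using card_subset_eq[OF _ sub] distinct_card[OF d] 1 by simp
      have "x r = p"
      proof -
        have "x r \<in> {p, q, r}"
          using permutes_in_image[OF perm, of r] unfolding all by simp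
        moreover have "x r \<noteq> q" "x r \<noteq> r"
          using d inj unfolding q_def r_def by auto
        ultimately show ?thesis by simp
      qed
      moreover have "x u = u" if "u \<notin> {p, q, r}" for u
        using that all perm unfolding permutes_def by simp
      ultimately have xc: "x = cycle_of_list [p, q, r]"
        using eq_three_cycleI[OF d] unfolding q_def r_def by blast
      have "generates_with n x x"
      proof (rule generates_withI[OF x])
        fix K
        assume K: "alt_subgroup n K" and xK: "x \<in> K"
        interpret alt_subgroup n K by (rule K)
        show "\<exists>a. {1..n} \<subseteq> link_class a"
          using linkedI_three_cycle[OF _ d] xK xc all by blast
      qed
      then show ?thesis by blast
    next
      case 2
      then show ?thesis
        using partner_two_orbits[of n x p q] d sub unfolding q_def by auto
    next
      case 3
      obtain b where b: "b \<in> {1..n}" "b \<notin> set [p, q, r]"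
        using ex_point_outside[of "[p, q, r]" n] 3 by auto
      have "distinct [p, q, b, r]" "{p, q, b, r} \<subseteq> {1..n}"
        using b d sub by auto
      then show ?thesis
        using partner_fixed_point[of n x p q q b r] 3 q_def r_def by simp
    next
      case 4
      obtain b where b: "b \<in> {1..n}" "b \<notin> set [p, q, r]"
        using ex_point_outside[of "[p, q, r]" n] 4 by auto
      have "distinct [p, b, q, r]" "{p, b, q, r} \<subseteq> {1..n}"
        using b d sub by auto
      then show ?thesis
        using partner_transposition[of n x p q q b r] 4 q_def r_def by simp
    next
      case 5
      show ?thesis
      proof (cases "x r = p")
        case False
        define s where "s = x r"
        have ds: "distinct [p, q, r, s]"
          using d False inj unfolding s_def q_def r_def by auto
        have sub': "{p, q, r, s} \<subseteq> {1..n}"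
          using sub moved[of r] ds unfolding s_def by auto
        obtain b where b: "b \<in> {1..n}" "b \<notin> set [p, q, r, s]"
          using ex_point_outside[of "[p, q, r, s]" n] 5 by auto
        obtain c where c: "c \<in> {1..n}" "c \<notin> set [p, q, r, s, b]"
          using ex_point_outside[of "[p, q, r, s, b]" n] 5 by auto
        show ?thesis
        proof (rule partner_two_fixed_points[OF 5(2,3), of x p q q b r r c s])
          show "x r \<notin> {q, b, c}"
            using ds b c by (auto simp flip: s_def)
        qed (use ds sub' b c q_def r_def s_def in auto)
      next
        case xr: True
        show ?thesis
        proof (cases "\<exists>v. v \<notin> {p, q, r} \<and> x v \<noteq> v")
          case True
          then obtain v where v: "v \<notin> {p, q, r}" "x v \<noteq> v"
            by blast
          define s where "s = x v"
          have ds: "distinct [p, q, r, v, s]"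
            using d v xr inj unfolding s_def q_def r_def by auto
          have sub': "{p, q, r, v, s} \<subseteq> {1..n}"
            using sub moved[of v] v unfolding s_def by auto
          obtain c where c: "c \<in> {1..n}" "c \<notin> set [p, q, r, v, s]"
            using ex_point_outside[of "[p, q, r, v, s]" n] 5 by auto
          show ?thesis
          proof (rule partner_two_fixed_points[OF 5(2,3), of x p q q v r v c s])
            show "x r \<notin> {q, v, c}"
              using xr ds c by auto
          qed (use ds sub' c q_def r_def s_def in auto)
        next
          case False
          then have "x = cycle_of_list [p, q, r]"
            using eq_three_cycleI[OF d] xr unfolding q_def r_def by blast
          then show ?thesis
            using partner_three_cycle[OF 5(2)] d sub by blast
        qed
      qed
    qed
  next
    case False
    then have inv: "x (x u) = u" for u
      by blast
    define q where "q = x p"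
    obtain r where r: "x r \<noteq> r" "r \<notin> {p, q}"
      using involution_moves_two_pairs[OF even inv p] unfolding q_def by blast
    define s where "s = x r"
    have xq: "x q = p" and xs: "x s = r"
      unfolding q_def s_def by (simp_all add: inv)
    have d: "distinct [p, q, r, s]"
      using p r inj xq xs unfolding q_def s_def by auto
    have sub: "{p, q, r, s} \<subseteq> {1..n}"
      using moved[OF p] moved[OF r(1)] unfolding q_def s_def by simp
    then have n4: "4 \<le> n"
      using card_mono[of "{1..n}" "set [p, q, r, s]"] distinct_card[OF d] by simp
    consider "even n" "\<not> 3 dvd n" | "5 \<le> n" "odd n" "n mod 3 \<noteq> 1"
      | "7 \<le> n" "odd n" "n mod 3 = 1" | "even n" "3 dvd n"
      using n4 by atomize_elim presburger
    then show ?thesis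
    proof cases
      case 1
      then show ?thesis
        using partner_two_orbits[of n x p q] n4 d sub unfolding q_def by auto
    next
      case 2
      show ?thesis
        using partner_fixed_point[of n x p q r r s] 2 q_def s_def d sub by auto
    next
      case 3
      show ?thesis
        using partner_transposition[of n x p q r r s] 3 q_def s_def d sub by auto
    next
      case 4
      show ?thesis
      proof (cases "\<exists>t. t \<notin> {p, q, r, s} \<and> x t \<noteq> t")
        case True
        then obtain t where t: "t \<notin> {p, q, r, s}" "x t \<noteq> t"
          by blast
        define u where "u = x t"
        have xu: "x u = t"
          unfolding u_def by (simp add: inv)
        have dt: "distinct [p, q, r, s, t, u]"
        proof -
          have "u \<noteq> p" "u \<noteq> q" "u \<noteq> r" "u \<noteq> s"
            using t xu xq xs q_def s_def by auto
          then show ?thesis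
            using d t unfolding u_def by auto
        qed
        have sub': "{p, q, r, s, t, u} \<subseteq> {1..n}"
          using sub moved[OF t(2)] unfolding u_def by simp
        obtain v where v: "x v \<noteq> v" "v \<notin> {p, q, r, s, t, u}"
          using involution_moves_four_pairs[OF even inv, of p r t] dt unfolding q_def s_def u_def by blast
        \<comment> \<open>without this, \<open>x\<close> could exchange two classes of three points each\<close>
        have "n \<noteq> 6"
        proof -
          have "distinct [p, q, r, s, t, u, v]" "set [p, q, r, s, t, u, v] \<subseteq> {1..n}"
            using dt v(2) sub' moved(1)[OF v(1)] by auto
          then show ?thesis
            using card_mono[of "{1..n}" "set [p, q, r, s, t, u, v]"]
              distinct_card[of "[p, q, r, s, t, u, v]"] by simp
        qed
        then show ?thesis
          by (intro partner_two_fixed_points[OF 4, of x p q r r s t t u])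
            (use dt sub' q_def s_def u_def in auto)
      next
        case False
        have x_eq: "x = transpose p q \<circ> transpose r s"
        proof
          fix u
          show "x u = (transpose p q \<circ> transpose r s) u"
          proof (cases "u \<in> {p, q, r, s}")
            case True
            then show ?thesis
              using d xq xs q_def s_def by (auto simp: transpose_def)
          next
            case other: False
            then have "x u = u"
              using False by blast
            then show ?thesis
              using other by simp
          qed
        qed
        have "n = 6 \<or> 8 \<le> n"
          using 4 n4 by presburger
        then show ?thesis
          using partner_double_transposition[OF 4(1) _ x_eq d sub]
            partner_double_transposition_six[OF x_eq d] sub by auto
      qed
    qed
  qed
qed

section \<open>Proper nontrivial subgroups\<close>

theorem theorem2p4:
  fixes n :: nat and H :: "(nat \<Rightarrow> nat) set"
  assumes "n \<ge> 1"
    and "proper_subgroup H (alt_group n)"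
    and "H \<noteq> {\<one>\<^bsub>alt_group n\<^esub>}"
  shows "FF_subgroup H (alt_group n)"
proof -
  interpret A: group "alt_group n"
    by (rule alt_group_is_group)
  have H: "subgroup H (alt_group n)"
    using assms(2) unfolding proper_subgroup_def by simp
  have finite: "finite (carrier (alt_group n))"
    by (rule finite_subset[OF _ finite_permutations[of "{1..n}"]]) (auto simp: alt_group_carrier)
  obtain x where x: "x \<in> H" "x \<noteq> id"
    using assms(3) subgroup.one_closed[OF H] by (auto simp: alt_group_one)
  then have "x \<in> carrier (alt_group n)"
    using subgroup.subset[OF H] by blast
  then obtain y where y: "y \<in> carrier (alt_group n)"
    and gen: "\<And>K. subgroup K (alt_group n) \<Longrightarrow> x \<in> K \<Longrightarrow> y \<in> K \<Longrightarrow> K = carrier (alt_group n)"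
    using ex_generating_partner[OF _ x(2)] unfolding generates_with_def by blast
  have "y \<notin> maximal_cover H (alt_group n)"
    using gen x(1) unfolding maximal_cover_def maximal_subgroup_def proper_subgroup_def by blast
  then show ?thesis
    unfolding FF_subgroup_def using y A.group_axioms finite assms(2) by blast
qed

end
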